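(* For each $k\in\omega$ let $$D_k=\{(x,y,z)\in{}^3({}^\omega2):(\exists n\ge k)(x(n)\neq y(n)\wedge x(n)\neq z(n)\wedge y(n+1)\neq z(n+1))\}.$$ Each $D_k$ is dense open, and $C=\bigcap_{n\in\omega}D_n$ is comeager in ${}^3({}^\omega2)$. For any $\Delta^1_1$ sets $A_0,A_1,A_2\subseteq{}^\omega2$ such that $E_0\le_{\Delta^1_1}E_0\upharpoonright A_i$ for each $i<3$ and $[A_0]_{E_0}=[A_1]_{E_0}=[A_2]_{E_0}$, we have $A_0\times_{E_0}A_1\times_{E_0}A_2\not\subseteq C$. Consequently $E_0$ does not have the weak $3$-Mycielski property.
   Context: $E_0$ on ${}^\omega2$: $x\,E_0\,y$ iff $(\exists n)(\forall k>n)(x(k)=y(k))$; $[A]_{E_0}$ is the $E_0$-saturation of $A$. $E\le_{\Delta^1_1}F$ means there is a $\Delta^1_1$ function $\Phi$ with $a\,E\,b\iff\Phi(a)\,F\,\Phi(b)$; $E\equiv_{\Delta^1_1}F$ means both directions. For an equivalence relation $E$ on $X$ and sets $A_0,\dots,A_{n-1}\subseteq X$, $A_0\times_E\cdots\times_E A_{n-1}=\prod^E_{i<n}A_i=\{(x_0,\dots,x_{n-1}):(\forall i)(x_i\in A_i)\wedge(\forall i\neq j)\neg(x_i\,E\,x_j)\}$. $E$ on a Polish space $X$ has the weak $n$-Mycielski property iff for every comeager $C\subseteq{}^nX$ there are $\Delta^1_1$ sets $A_i$ ($i<n$) with $E\equiv_{\Delta^1_1}E\upharpoonright A_i$ for each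 $i$ and $\prod^E_{i<n}A_i\subseteq C$.
   Formalization: In the last sentence, the weak 3-Mycielski property is taken with the extra requirement that the sets A_i have the same E_0-saturation; without it, E_0 does have the weak n-Mycielski property for every n, so the sentence as worded is false. *)

theory Defs
  imports "HOL-Analysis.Analysis"
begin

text \<open>
  The boldface projective classes. They are used for types carrying a Polish topology, such as
  \<^typ>\<open>nat \<Rightarrow> bool\<close> (the product of discrete spaces, that is, Cantor space). Baire space is
  \<^typ>\<open>nat \<Rightarrow> nat\<close>.
\<close>

definition sigma11 :: "'a::topological_space set \<Rightarrow> bool" where
  "sigma11 A \<longleftrightarrow> (\<exists>F :: ('a \<times> (nat \<Rightarrow> nat)) set. closed F \<and> A = fst ` F)"

definition pi11 :: "'a::topological_space set \<Rightarrow> bool" where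
  "pi11 A \<longleftrightarrow> sigma11 (- A)"

definition delta11 :: "'a::topological_space set \<Rightarrow> bool" where
  "delta11 A \<longleftrightarrow> sigma11 A \<and> pi11 A"

definition delta11_fun_on :: "'a::topological_space set \<Rightarrow> ('a \<Rightarrow> 'b::topological_space) \<Rightarrow> bool" where
  "delta11_fun_on X \<Phi> \<longleftrightarrow> (\<forall>U. open U \<longrightarrow> delta11 {x \<in> X. \<Phi> x \<in> U})"

text \<open>
  Relations are paired with their underlying sets: \<open>E\<close> is a relation on \<open>X\<close>, \<open>F\<close> one on \<open>Y\<close>. The
  restriction of \<open>E\<close> to \<open>A\<close> is thus the pair of \<open>A\<close> and \<^term>\<open>Restr E A\<close>.
\<close>

definition delta11_reducible ::
    "'a::topological_space set \<Rightarrow> 'a rel \<Rightarrow> 'b::topological_space set \<Rightarrow> 'b rel \<Rightarrow> bool" where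
  "delta11_reducible X E Y F \<longleftrightarrow>
     (\<exists>\<Phi>. \<Phi> ` X \<subseteq> Y \<and> delta11_fun_on X \<Phi> \<and>
          (\<forall>a\<in>X. \<forall>b\<in>X. (a, b) \<in> E \<longleftrightarrow> (\<Phi> a, \<Phi> b) \<in> F))"

definition delta11_bireducible ::
    "'a::topological_space set \<Rightarrow> 'a rel \<Rightarrow> 'b::topological_space set \<Rightarrow> 'b rel \<Rightarrow> bool" where
  "delta11_bireducible X E Y F \<longleftrightarrow> delta11_reducible X E Y F \<and> delta11_reducible Y F X E"

definition nowhere_dense_in :: "'a topology \<Rightarrow> 'a set \<Rightarrow> bool" where
  "nowhere_dense_in T S \<longleftrightarrow> S \<subseteq> topspace T \<and> T interior_of (T closure_of S) = {}"

definition meager_in :: "'a topology \<Rightarrow> 'a set \<Rightarrow> bool" where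
  "meager_in T S \<longleftrightarrow> (\<exists>N :: nat \<Rightarrow> 'a set. (\<forall>n. nowhere_dense_in T (N n)) \<and> S = (\<Union>n. N n))"

definition comeager_in :: "'a topology \<Rightarrow> 'a set \<Rightarrow> bool" where
  "comeager_in T C \<longleftrightarrow> C \<subseteq> topspace T \<and> meager_in T (topspace T - C)"

text \<open>
  An element of the \<open>n\<close>-th power of a space is a function on \<^term>\<open>{..<n}\<close>, extended by
  \<^const>\<open>undefined\<close> to all of \<^typ>\<open>nat\<close>.
\<close>

definition power_topology :: "nat \<Rightarrow> (nat \<Rightarrow> 'a::topological_space) topology" where
  "power_topology n = product_topology (\<lambda>_. euclidean) {..<n}"

definition prod_mod :: "nat \<Rightarrow> 'a rel \<Rightarrow> (nat \<Rightarrow> 'a set) \<Rightarrow> (nat \<Rightarrow> 'a) set" where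
  "prod_mod n E A =
     {p \<in> Pi\<^sub>E {..<n} A. \<forall>i<n. \<forall>j<n. i \<noteq> j \<longrightarrow> (p i, p j) \<notin> E}"

text \<open>
  The weak \<open>n\<close>-Mycielski property, for \<open>E\<close> on a Polish space. The usual wording does not say that
  the \<open>A i\<close> have the same \<open>E\<close>-saturation; that clause is added here. Without it, the eventual
  equality relation \<open>E0\<close> below has the property for every \<open>n\<close>. Indeed, given dense open sets
  \<open>O m\<close> in the \<open>n\<close>-th power of Cantor space, finite binary words \<open>t i m\<close> (\<open>i < n\<close>) with
  \<open>length (t i m)\<close> independent of \<open>i\<close> can be chosen successively in \<open>m\<close>, so that the product of the
  closed sets \<open>A i\<close> of all sequences \<open>t i 0, b\<^sub>0, t i 1, b\<^sub>1, \<dots>\<close> with bits \<open>b\<^sub>0, b\<^sub>1, \<dots>\<close> lies in every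
  \<open>O m\<close>: only finitely many combinations of earlier bits have to be met at stage \<open>m\<close>. Inserting the
  bits reduces \<open>E0\<close> to its restriction to \<open>A i\<close>. For the particular set \<open>(\<Inter>k. D k)\<close> below one can
  take \<open>A 0 = {x. \<forall>m. \<not> x (4*m)}\<close>, \<open>A 1 = {x. \<forall>m. x (4*m) \<and> \<not> x (4*m+1)}\<close> and
  \<open>A 2 = {x. \<forall>m. x (4*m) \<and> x (4*m+1)}\<close>.
\<close>

definition weak_mycielski :: "nat \<Rightarrow> 'a::topological_space rel \<Rightarrow> bool" where
  "weak_mycielski n E \<longleftrightarrow>
     (\<forall>C. comeager_in (power_topology n) C \<longrightarrow>
        (\<exists>A. (\<forall>i<n. delta11 (A i) \<and> delta11_bireducible UNIV E (A i) (Restr E (A i))) \<and>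
             (\<forall>i<n. \<forall>j<n. E `` A i = E `` A j) \<and>
             prod_mod n E A \<subseteq> C))"

definition E0 :: "(nat \<Rightarrow> bool) rel" where
  "E0 = {(x, y). \<exists>n. \<forall>k>n. x k = y k}"

definition D :: "nat \<Rightarrow> (nat \<Rightarrow> nat \<Rightarrow> bool) set" where
  "D k = {p \<in> topspace (power_topology 3).
     \<exists>n\<ge>k. p 0 n \<noteq> p 1 n \<and> p 0 n \<noteq> p 2 n \<and> p 1 (n + 1) \<noteq> p 2 (n + 1)}"

end

theory Submission
  imports Defs
begin

text \<open>
  Let \<open>\<Phi>\<close> reduce \<^const>\<open>E0\<close> to its restriction to \<open>A 0\<close>. As the three sets have the same saturation and
  analytic sets have the Baire property, on a suitable cylinder finite modifications \<open>F1\<close>, \<open>F2\<close> of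
  \<open>\<Phi> x\<close> lie in \<open>A 1\<close>, \<open>A 2\<close> for almost all \<open>x\<close>. Inside this cylinder a fusion argument yields a
  copy of Cantor space such that the coordinates of \<open>\<Phi> x\<close> split into consecutive nonempty blocks,
  the \<open>n\<close>-th of which depends only on the \<open>n\<close>-th free bit of \<open>x\<close>. Take \<open>x\<close>, \<open>y\<close>, \<open>z\<close> whose \<open>n\<close>-th free
  bits all agree, except that \<open>x\<close> is the odd one out when \<open>n mod 4 = 0\<close> and \<open>y\<close> when \<open>n mod 4 = 2\<close>.
  Wherever the image of \<open>x\<close> differs from the other two, the block has index divisible by 4, and so the
  images of \<open>y\<close> and \<open>z\<close> agree on this block and on the next one. Hence the modified images avoid
  \<open>D k\<close> for large \<open>k\<close>.
\<close>

section \<open>Cylinders and Baire category in Cantor space\<close>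

text \<open>Polymorphic in the values because cylinders occur in Cantor space and, in
  \<open>sigma11_Souslin\<close>, in Baire space.\<close>

definition cyl :: "(nat \<Rightarrow> 'a) \<Rightarrow> nat \<Rightarrow> (nat \<Rightarrow> 'a) set" where
  "cyl a p = {y. \<forall>i<p. y i = a i}"

lemma cyl_self [simp]: "a \<in> cyl a p"
  by (simp add: cyl_def)

lemma cyl_0 [simp]: "cyl a 0 = UNIV"
  by (simp add: cyl_def)

lemma cyl_antimono: "p \<le> q \<Longrightarrow> cyl a q \<subseteq> cyl a p"
  by (auto simp: cyl_def)

lemma open_cyl: "open (cyl a p :: (nat \<Rightarrow> 'a::discrete_topology) set)"
proof -
  have "cyl a p = (\<Inter>i\<in>{..<p}. (\<lambda>y. y i) -` {a i})"
    by (auto simp: cyl_def)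
  moreover have "open ((\<lambda>y. y i) -` {a i})" for i
    by (intro open_vimage continuous_on_product_coordinates) (simp add: open_discrete)
  ultimately show ?thesis by (auto intro!: open_INT)
qed

lemma open_contains_cyl:
  fixes U :: "(nat \<Rightarrow> 'a::discrete_topology) set"
  assumes "open U" "x \<in> U"
  shows "\<exists>n. cyl x n \<subseteq> U"
proof -
  have "openin (product_topology (\<lambda>_. euclidean) UNIV) U"
    using assms(1) by (simp add: open_fun_def)
  from product_topology_open_contains_basis[OF this assms(2)]
  obtain X where X: "x \<in> (\<Pi>\<^sub>E i\<in>UNIV. X i)" "finite {i. X i \<noteq> UNIV}" "(\<Pi>\<^sub>E i\<in>UNIV. X i) \<subseteq> U"
    by auto
  obtain n where n: "\<And>i. X i \<noteq> UNIV \<Longrightarrow> i < n"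
    using finite_nat_bounded[OF X(2)] by auto
  have "cyl x n \<subseteq> (\<Pi>\<^sub>E i\<in>UNIV. X i)"
  proof
    fix y assume y: "y \<in> cyl x n"
    have "y i \<in> X i" for i
    proof (cases "i < n")
      case True
      then have "y i = x i" using y by (simp add: cyl_def)
      then show ?thesis using X(1) by auto
    next
      case False
      then show ?thesis using n by auto
    qed
    then show "y \<in> (\<Pi>\<^sub>E i\<in>UNIV. X i)" by auto
  qed
  then show ?thesis using X(3) by blast
qed

text \<open>Coordinates below \<open>p n\<close> are frozen from stage \<open>n\<close> on, and
  \<open>i < p (Suc i)\<close>, so the diagonal \<open>a (Suc i) i\<close> is the limit.\<close>

lemma cyl_limit:
  assumes "\<And>n. a (Suc n) \<in> cyl (a n) (p n)" "strict_mono (p :: nat \<Rightarrow> nat)"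
  obtains c where "\<And>n. c \<in> cyl (a n) (p n)"
proof -
  have step: "a m i = a n i" if "n \<le> m" "i < p n" for m n i
    using that
  proof (induction m rule: dec_induct)
    case (step m)
    then have "i < p m"
      using assms(2) by (meson less_le_trans strict_mono_less_eq)
    then have "a (Suc m) i = a m i" using assms(1)[of m] by (simp add: cyl_def)
    then show ?case using step by simp
  qed simp
  have ge: "i < p (Suc i)" for i
    using strict_mono_imp_increasing[OF assms(2), of "Suc i"] by simp
  have "(\<lambda>i. a (Suc i) i) \<in> cyl (a n) (p n)" for n
  proof (unfold cyl_def, safe)
    fix i assume i: "i < p n"
    show "a (Suc i) i = a n i"
      using step[of n "Suc i" i] step[of "Suc i" n i] i ge[of i] by (cases "n \<le> Suc i") auto
  qed
  then show thesis by (rule that)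
qed

text \<open>Every member contains a point, so density can be tested on \<open>Cyl\<close> with no
  side condition of nonemptiness.\<close>

definition Cyl :: "(nat \<Rightarrow> bool) set set" where
  "Cyl = {cyl a p | a p. True}"

lemma cyl_in_Cyl [simp]: "cyl a p \<in> Cyl"
  by (auto simp: Cyl_def)

lemma UNIV_in_Cyl [simp]: "UNIV \<in> Cyl"
  using cyl_in_Cyl[of _ 0] by simp

lemma Cyl_eq_cyl: "V \<in> Cyl \<Longrightarrow> x \<in> V \<Longrightarrow> \<exists>p. V = cyl x p"
  by (auto simp: Cyl_def cyl_def)

lemma Cyl_Int:
  assumes "V \<in> Cyl" "W \<in> Cyl" "V \<inter> W \<noteq> {}"
  shows "V \<inter> W \<in> Cyl"
proof -
  obtain x where "x \<in> V" "x \<in> W" using assms(3) by auto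
  then obtain p q where "V = cyl x p" "W = cyl x q"
    using Cyl_eq_cyl assms by metis
  then have "V \<inter> W = cyl x (max p q)" by (auto simp: cyl_def less_max_iff_disj)
  then show ?thesis by simp
qed

lemma countable_Cyl: "countable Cyl"
proof -
  have "Cyl \<subseteq> range (\<lambda>l. {y. map y [0..<length l] = l})"
  proof
    fix V assume "V \<in> Cyl"
    then obtain a p where "V = cyl a p" by (auto simp: Cyl_def)
    then have "V = {y. map y [0..<length (map a [0..<p])] = map a [0..<p]}"
      by (auto simp: cyl_def)
    then show "V \<in> range (\<lambda>l. {y. map y [0..<length l] = l})" by blast
  qed
  then show ?thesis by (rule countable_subset) simp
qed

section \<open>Meagre sets in Cantor space\<close>

definition nwd :: "(nat \<Rightarrow> bool) set \<Rightarrow> bool" where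
  "nwd K \<longleftrightarrow> (\<forall>V\<in>Cyl. \<exists>W\<in>Cyl. W \<subseteq> V \<and> W \<inter> K = {})"

text \<open>An inclusion rather than an equality, which builds in closure under subsets. This notion
  serves the category arguments in a single copy of Cantor space; \<open>meager_in\<close> concerns
  the power.\<close>

definition meagre :: "(nat \<Rightarrow> bool) set \<Rightarrow> bool" where
  "meagre S \<longleftrightarrow> (\<exists>\<K>. countable \<K> \<and> (\<forall>K\<in>\<K>. nwd K) \<and> S \<subseteq> \<Union>\<K>)"

lemma nwd_empty [simp]: "nwd {}"
  unfolding nwd_def by blast

lemma nwd_imp_meagre: "nwd K \<Longrightarrow> meagre K"
  unfolding meagre_def by (rule exI[of _ "{K}"]) simp

lemma meagre_subset: "meagre T \<Longrightarrow> S \<subseteq> T \<Longrightarrow> meagre S"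
  unfolding meagre_def by (meson subset_trans)

lemma meagre_empty [simp]: "meagre {}"
  by (rule nwd_imp_meagre[OF nwd_empty])

lemma meagre_UN:
  assumes "countable I" "\<And>i. i \<in> I \<Longrightarrow> meagre (S i)"
  shows "meagre (\<Union>i\<in>I. S i)"
proof -
  have "\<forall>i\<in>I. \<exists>\<K>. countable \<K> \<and> (\<forall>K\<in>\<K>. nwd K) \<and> S i \<subseteq> \<Union>\<K>"
    using assms(2) by (simp add: meagre_def)
  then obtain \<K> where *: "\<forall>i\<in>I. countable (\<K> i) \<and> (\<forall>K\<in>\<K> i. nwd K) \<and> S i \<subseteq> \<Union>(\<K> i)"
    by metis
  show ?thesis
    unfolding meagre_def
  proof (intro exI[of _ "\<Union>i\<in>I. \<K> i"] conjI)
    show "countable (\<Union>i\<in>I. \<K> i)" using * assms(1) by auto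
    show "\<forall>K\<in>\<Union>i\<in>I. \<K> i. nwd K" using * by auto
    show "(\<Union>i\<in>I. S i) \<subseteq> \<Union>(\<Union>i\<in>I. \<K> i)"
    proof
      fix x assume "x \<in> (\<Union>i\<in>I. S i)"
      then obtain i where "i \<in> I" "x \<in> S i" by auto
      then have "x \<in> \<Union>(\<K> i)" using bspec[OF * \<open>i \<in> I\<close>] by blast
      then show "x \<in> \<Union>(\<Union>i\<in>I. \<K> i)" using \<open>i \<in> I\<close> by auto
    qed
  qed
qed

lemma meagre_Un:
  assumes "meagre S" "meagre T"
  shows "meagre (S \<union> T)"
proof -
  have "meagre (if b then S else T)" for b
    using assms by simp
  then have "meagre (\<Union>b\<in>UNIV. if b then S else T)" by (intro meagre_UN) simp_all
  then show ?thesis by (simp add: UNIV_bool Un_commute)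
qed

lemma meagre_nwd_sequence:
  assumes "meagre S"
  obtains K where "\<And>n::nat. nwd (K n)" "S \<subseteq> (\<Union>n. K n)"
proof -
  obtain \<K> where \<K>: "countable \<K>" "\<forall>K\<in>\<K>. nwd K" "S \<subseteq> \<Union>\<K>"
    using assms by (auto simp: meagre_def)
  \<comment> \<open>Inserting the nowhere dense set \<open>{}\<close> makes the family nonempty,
    hence the range of an enumeration.\<close>
  define K where "K = from_nat_into (insert {} \<K>)"
  have "range K = insert {} \<K>"
    unfolding K_def using \<K>(1) by (intro range_from_nat_into) auto
  moreover have "nwd (K n)" for n
  proof -
    have "K n \<in> insert {} \<K>" using calculation by (metis rangeI)
    then show ?thesis using \<K>(2) by auto
  qed
  ultimately show thesis using \<K>(3) by (intro that[of K]) auto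
qed

text \<open>Baire category theorem: shrink to cylinders avoiding \<open>K 0\<close>,
  \<open>K 1\<close> and so on in turn; their lengths grow, so \<open>cyl_limit\<close> yields a
  common point.\<close>

lemma Cyl_not_meagre:
  assumes "V \<in> Cyl"
  shows "\<not> meagre V"
proof
  assume "meagre V"
  then obtain K where K: "\<And>n::nat. nwd (K n)" "V \<subseteq> (\<Union>n. K n)"
    using meagre_nwd_sequence by blast
  obtain a0 p0 where V: "V = cyl a0 p0" using assms by (auto simp: Cyl_def)
  have "\<exists>f :: nat \<Rightarrow> (nat \<Rightarrow> bool) \<times> nat. f 0 = (a0, p0) \<and>
    (\<forall>n. fst (f (Suc n)) \<in> cyl (fst (f n)) (snd (f n)) \<and> snd (f n) < snd (f (Suc n)) \<and>
         cyl (fst (f (Suc n))) (snd (f (Suc n))) \<inter> K n = {})"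
  proof (rule dependent_nat_choice[of "\<lambda>n s. n = 0 \<longrightarrow> s = (a0, p0)"
      "\<lambda>n s t. fst t \<in> cyl (fst s) (snd s) \<and> snd s < snd t \<and> cyl (fst t) (snd t) \<inter> K n = {}",
      THEN exE], goal_cases)
    case (2 s n)
    obtain W where W: "W \<in> Cyl" "W \<subseteq> cyl (fst s) (snd s)" "W \<inter> K n = {}"
      using K(1)[of n] cyl_in_Cyl unfolding nwd_def by blast
    obtain b q where "W = cyl b q" using W(1) by (auto simp: Cyl_def)
    \<comment> \<open>The maximum forces the length to increase strictly.\<close>
    then show ?case
      using W cyl_antimono[of q "max q (Suc (snd s))" b] cyl_self[of b q]
      by (intro exI[of _ "(b, max q (Suc (snd s)))"]) auto
  qed auto
  then obtain f where f: "f 0 = (a0, p0)"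
    "\<And>n. fst (f (Suc n)) \<in> cyl (fst (f n)) (snd (f n))" "\<And>n. snd (f n) < snd (f (Suc n))"
    "\<And>n. cyl (fst (f (Suc n))) (snd (f (Suc n))) \<inter> K n = {}"
    by blast
  obtain c where c: "\<And>n. c \<in> cyl (fst (f n)) (snd (f n))"
    using cyl_limit[of "\<lambda>n. fst (f n)" "\<lambda>n. snd (f n)"] f(2,3) by (auto simp: strict_mono_Suc_iff)
  have "c \<in> V" using c[of 0] f(1) V by simp
  then obtain n where "c \<in> K n" using K(2) by auto
  then show False using c[of "Suc n"] f(4)[of n] by auto
qed

text \<open>The union of the cylinders on which \<open>S\<close> is meagre has a nowhere dense
  complement, and there are only countably many cylinders.\<close>

lemma meagre_locally:
  assumes "\<And>V. V \<in> Cyl \<Longrightarrow> \<exists>W\<in>Cyl. W \<subseteq> V \<and> meagre (S \<inter> W)"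
  shows "meagre S"
proof -
  define \<V> where "\<V> = {V\<in>Cyl. meagre (S \<inter> V)}"
  have "nwd (- \<Union>\<V>)"
    unfolding nwd_def \<V>_def using assms by blast
  moreover have "meagre (\<Union>V\<in>\<V>. S \<inter> V)"
    by (intro meagre_UN countable_subset[OF _ countable_Cyl]) (auto simp: \<V>_def)
  ultimately have "meagre ((- \<Union>\<V>) \<union> (\<Union>V\<in>\<V>. S \<inter> V))"
    using meagre_Un nwd_imp_meagre by blast
  then show ?thesis by (rule meagre_subset) auto
qed

section \<open>The Baire property\<close>

text \<open>By second countability, this is equivalent to the Baire property.\<close>

definition baire_prop :: "(nat \<Rightarrow> bool) set \<Rightarrow> bool" where
  "baire_prop S \<longleftrightarrow> (\<forall>V\<in>Cyl. \<exists>W\<in>Cyl. W \<subseteq> V \<and> (meagre (S \<inter> W) \<or> meagre (W - S)))"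

text \<open>Without such a \<open>W\<close>, the Baire property would make \<open>S\<close> meagre
  on a subcylinder of every cylinder inside \<open>V\<close>, and \<open>S \<inter> V\<close> would
  be meagre by \<open>meagre_locally\<close>.\<close>

lemma baire_prop_nonmeagre:
  assumes "baire_prop S" "V \<in> Cyl" "\<not> meagre (S \<inter> V)"
  shows "\<exists>W\<in>Cyl. W \<subseteq> V \<and> meagre (W - S)"
proof (rule ccontr)
  assume no: "\<not> ?thesis"
  have "meagre (S \<inter> V)"
  proof (rule meagre_locally)
    fix U assume U: "U \<in> Cyl"
    show "\<exists>W\<in>Cyl. W \<subseteq> U \<and> meagre (S \<inter> V \<inter> W)"
    proof (cases "U \<inter> V = {}")
      case True
      then have "S \<inter> V \<inter> U = {}" by auto
      then show ?thesis using U by (metis meagre_empty order_refl)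
    next
      case False
      then have "U \<inter> V \<in> Cyl" using Cyl_Int U assms(2) by blast
      then obtain W where "W \<in> Cyl" "W \<subseteq> U \<inter> V" "meagre (S \<inter> W) \<or> meagre (W - S)"
        using assms(1) unfolding baire_prop_def by blast
      then show ?thesis using no meagre_subset[of "S \<inter> W" "S \<inter> V \<inter> W"] by blast
    qed
  qed
  then show False using assms(3) by simp
qed

text \<open>By Baire category some \<open>S i\<close> is nonmeagre in \<open>V\<close>. This is how
  a choice depending on the point becomes uniform on a cylinder.\<close>

lemma baire_prop_cover:
  assumes "V \<in> Cyl" "countable I" "\<And>i. i \<in> I \<Longrightarrow> baire_prop (S i)" "V \<subseteq> (\<Union>i\<in>I. S i)"
  shows "\<exists>i\<in>I. \<exists>W\<in>Cyl. W \<subseteq> V \<and> meagre (W - S i)"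
proof -
  have "\<exists>i\<in>I. \<not> meagre (S i \<inter> V)"
  proof (rule ccontr)
    assume "\<not> ?thesis"
    then have "meagre (\<Union>i\<in>I. S i \<inter> V)" by (intro meagre_UN assms(2)) auto
    then have "meagre V" by (rule meagre_subset) (use assms(4) in auto)
    then show False using Cyl_not_meagre assms(1) by blast
  qed
  then show ?thesis using baire_prop_nonmeagre assms(1,3) by blast
qed

lemma baire_prop_Compl: "baire_prop S \<Longrightarrow> baire_prop (- S)"
  by (simp add: baire_prop_def Diff_eq Int_commute disj_commute)

text \<open>Either some \<open>S i\<close> is nonmeagre in \<open>V\<close> and almost fills a
  subcylinder, or the whole union is meagre in \<open>V\<close>.\<close>

lemma baire_prop_UN:
  assumes "countable I" "\<And>i. i \<in> I \<Longrightarrow> baire_prop (S i)"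
  shows "baire_prop (\<Union>i\<in>I. S i)"
  unfolding baire_prop_def
proof
  fix V assume V: "V \<in> Cyl"
  show "\<exists>W\<in>Cyl. W \<subseteq> V \<and> (meagre ((\<Union>i\<in>I. S i) \<inter> W) \<or> meagre (W - (\<Union>i\<in>I. S i)))"
  proof (cases "\<exists>i\<in>I. \<not> meagre (S i \<inter> V)")
    case True
    then obtain i where i: "i \<in> I" "\<not> meagre (S i \<inter> V)" by blast
    then obtain W where W: "W \<in> Cyl" "W \<subseteq> V" "meagre (W - S i)"
      using baire_prop_nonmeagre[OF assms(2) V] by blast
    have "meagre (W - (\<Union>i\<in>I. S i))"
      by (rule meagre_subset[OF W(3)]) (use i(1) in auto)
    then show ?thesis using W(1,2) by blast
  next
    case False
    then have "meagre (\<Union>i\<in>I. S i \<inter> V)" by (intro meagre_UN assms(1)) auto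
    then have "meagre ((\<Union>i\<in>I. S i) \<inter> V)" by (rule meagre_subset) auto
    then show ?thesis using V by blast
  qed
qed

lemma baire_prop_INT:
  assumes "countable I" "\<And>i. i \<in> I \<Longrightarrow> baire_prop (S i)"
  shows "baire_prop (\<Inter>i\<in>I. S i)"
proof -
  have "baire_prop (\<Union>i\<in>I. - S i)"
    by (rule baire_prop_UN[OF assms(1) baire_prop_Compl[OF assms(2)]])
  from baire_prop_Compl[OF this] show ?thesis by simp
qed

lemma baire_prop_Int:
  assumes "baire_prop S" "baire_prop T"
  shows "baire_prop (S \<inter> T)"
proof -
  have "baire_prop (if b then S else T)" for b
    using assms by simp
  then have "baire_prop (\<Inter>b\<in>UNIV. if b then S else T)" by (intro baire_prop_INT) simp_all
  then show ?thesis by (simp add: UNIV_bool Int_commute Un_commute)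
qed

lemma baire_prop_Un:
  assumes "baire_prop S" "baire_prop T"
  shows "baire_prop (S \<union> T)"
proof -
  have "baire_prop (if b then S else T)" for b
    using assms by simp
  then have "baire_prop (\<Union>b\<in>UNIV. if b then S else T)" by (intro baire_prop_UN) simp_all
  then show ?thesis by (simp add: UNIV_bool Int_commute Un_commute)
qed

lemma baire_prop_meagre_diff:
  assumes "baire_prop S" "meagre (S - T)" "meagre (T - S)"
  shows "baire_prop T"
  unfolding baire_prop_def
proof
  fix V assume "V \<in> Cyl"
  then obtain W where W: "W \<in> Cyl" "W \<subseteq> V" "meagre (S \<inter> W) \<or> meagre (W - S)"
    using assms(1) unfolding baire_prop_def by blast
  have "meagre (T \<inter> W)" if "meagre (S \<inter> W)"
    by (rule meagre_subset[OF meagre_Un[OF that assms(3)]]) auto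
  moreover have "meagre (W - T)" if "meagre (W - S)"
    by (rule meagre_subset[OF meagre_Un[OF that assms(2)]]) auto
  ultimately have "meagre (T \<inter> W) \<or> meagre (W - T)" using W(3) by blast
  then show "\<exists>W\<in>Cyl. W \<subseteq> V \<and> (meagre (T \<inter> W) \<or> meagre (W - T))" using W by blast
qed

lemma baire_prop_open:
  assumes "open U"
  shows "baire_prop U"
  unfolding baire_prop_def
proof
  fix V assume V: "V \<in> Cyl"
  show "\<exists>W\<in>Cyl. W \<subseteq> V \<and> (meagre (U \<inter> W) \<or> meagre (W - U))"
  proof (cases "U \<inter> V = {}")
    case True
    then show ?thesis using V by (intro bexI[of _ V]) auto
  next
    case False
    then obtain x where x: "x \<in> U" "x \<in> V" by auto
    obtain n where "cyl x n \<subseteq> U" using open_contains_cyl assms x(1) by blast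
    moreover have "cyl x n \<inter> V \<in> Cyl"
      using V x(2) cyl_self[of x n] by (intro Cyl_Int) (simp, simp, blast)
    moreover have "meagre (cyl x n \<inter> V - U)"
      by (rule meagre_subset[OF meagre_empty]) (use \<open>cyl x n \<subseteq> U\<close> in auto)
    ultimately show ?thesis by (intro bexI[of _ "cyl x n \<inter> V"]) auto
  qed
qed

lemma baire_prop_closed: "closed C \<Longrightarrow> baire_prop C"
  using baire_prop_Compl[OF baire_prop_open[OF open_Compl]] by simp

section \<open>The Souslin operation and analytic sets\<close>

text \<open>The complement of the largest open set in which \<open>S\<close> is meagre. It contains
  \<open>S\<close> only up to a meagre set.\<close>

definition meagre_hull :: "(nat \<Rightarrow> bool) set \<Rightarrow> (nat \<Rightarrow> bool) set" where
  "meagre_hull S = - \<Union>{V\<in>Cyl. meagre (S \<inter> V)}"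

lemma baire_prop_meagre_hull: "baire_prop (meagre_hull S)"
proof -
  have "open V" if "V \<in> Cyl" for V
    using that open_cyl by (auto simp: Cyl_def)
  then have "closed (meagre_hull S)"
    unfolding meagre_hull_def by (intro closed_Compl open_Union) auto
  then show ?thesis by (rule baire_prop_closed)
qed

lemma meagre_Diff_meagre_hull: "meagre (S - meagre_hull S)"
proof -
  have "meagre (\<Union>V\<in>{V\<in>Cyl. meagre (S \<inter> V)}. S \<inter> V)"
    by (intro meagre_UN countable_subset[OF _ countable_Cyl]) auto
  then show ?thesis by (rule meagre_subset) (auto simp: meagre_hull_def)
qed

text \<open>Minimality of the hull: a nonmeagre \<open>T\<close> would almost fill a cylinder
  \<open>W\<close>; then \<open>S\<close> would be meagre in \<open>W\<close>, so \<open>W\<close>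
  would miss the hull and hence \<open>T\<close>.\<close>

lemma meagre_in_meagre_hull:
  assumes "baire_prop T" "T \<subseteq> meagre_hull S" "meagre (S \<inter> T)"
  shows "meagre T"
proof (rule ccontr)
  assume "\<not> meagre T"
  then obtain W where W: "W \<in> Cyl" "meagre (W - T)"
    using baire_prop_nonmeagre[of T UNIV] assms(1) by auto
  have "meagre ((W - T) \<union> (S \<inter> T))" using W assms(3) by (intro meagre_Un)
  then have "meagre (S \<inter> W)" by (rule meagre_subset) auto
  then have "W \<inter> meagre_hull S = {}" using W(1) by (auto simp: meagre_hull_def)
  then have "W - T = W" using assms(2) by auto
  then show False using W Cyl_not_meagre by metis
qed

text \<open>Nikodym's theorem. Up to meagre sets, the hull \<open>E s\<close> of the points with a
  branch through \<open>s\<close> is covered by the hulls of the one-step extensions and contained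
  in \<open>P s\<close>. Off these countably many errors, every point of \<open>E []\<close> follows
  a branch, so \<open>A []\<close> and its hull differ by a meagre set.\<close>

lemma baire_prop_Souslin:
  fixes P :: "nat list \<Rightarrow> (nat \<Rightarrow> bool) set"
  assumes P: "\<And>s. baire_prop (P s)"
  shows "baire_prop {x. \<exists>f. \<forall>n. x \<in> P (map f [0..<n])}"
proof -
  define A where
    "A s = {x. \<exists>f. map f [0..<length s] = s \<and> (\<forall>n. x \<in> P (map f [0..<n]))}" for s
  define E where "E s = meagre_hull (A s)" for s
  have A_split: "A s \<subseteq> (\<Union>k. A (s @ [k]))" for s
  proof
    fix x assume "x \<in> A s"
    then obtain f where "map f [0..<length s] = s" "\<forall>n. x \<in> P (map f [0..<n])"
      by (auto simp: A_def)
    then have "x \<in> A (s @ [f (length s)])" by (auto simp: A_def intro!: exI[of _ f])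
    then show "x \<in> (\<Union>k. A (s @ [k]))" by blast
  qed
  have A_sub: "A s \<subseteq> P s" for s
  proof
    fix x assume "x \<in> A s"
    then obtain f where "map f [0..<length s] = s" "\<forall>n. x \<in> P (map f [0..<n])"
      by (auto simp: A_def)
    then show "x \<in> P s" by metis
  qed
  have E_bp: "baire_prop (E s)" for s
    unfolding E_def by (rule baire_prop_meagre_hull)
  \<comment> \<open>The error lies inside the hull of \<open>A s\<close> but almost misses
    \<open>A s\<close>, so it is meagre by minimality.\<close>
  have m1: "meagre (E s - (\<Union>k. E (s @ [k])))" for s
  proof (rule meagre_in_meagre_hull[of _ "A s"])
    show "baire_prop (E s - (\<Union>k. E (s @ [k])))"
      unfolding Diff_eq by (intro baire_prop_Int baire_prop_Compl baire_prop_UN E_bp) simp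
    have "meagre (\<Union>k. A (s @ [k]) - E (s @ [k]))"
      by (intro meagre_UN) (simp_all add: E_def meagre_Diff_meagre_hull)
    then show "meagre (A s \<inter> (E s - (\<Union>k. E (s @ [k]))))"
      by (rule meagre_subset) (use A_split[of s] in auto)
  qed (auto simp: E_def)
  have m2: "meagre (E s - P s)" for s
  proof (rule meagre_in_meagre_hull[of _ "A s"])
    show "baire_prop (E s - P s)"
      unfolding Diff_eq by (intro baire_prop_Int baire_prop_Compl E_bp P)
    have "A s \<inter> (E s - P s) = {}" using A_sub by auto
    then show "meagre (A s \<inter> (E s - P s))" by simp
  qed (auto simp: E_def)
  have "E [] - A [] \<subseteq> (\<Union>s. E s - (\<Union>k. E (s @ [k]))) \<union> (\<Union>s. E s - P s)"
  proof (rule ccontr)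
    assume "\<not> ?thesis"
    then obtain x where x: "x \<in> E []" "x \<notin> A []"
      and "x \<notin> (\<Union>s. E s - (\<Union>k. E (s @ [k])))" "x \<notin> (\<Union>s. E s - P s)"
      unfolding subset_iff by auto
    then have ext: "\<exists>k. x \<in> E (s @ [k])" and inP: "x \<in> P s" if "x \<in> E s" for s
      using that by auto
    \<comment> \<open>Descend through the hulls; tracking the length makes the word at stage 0
      empty, and the branch \<open>f\<close> is read off from the last entries.\<close>
    have "\<exists>s. \<forall>n. (x \<in> E (s n) \<and> length (s n) = n) \<and> (\<exists>k. s (Suc n) = s n @ [k])"
    proof (rule dependent_nat_choice)
      show "\<exists>s. x \<in> E s \<and> length s = 0" using x(1) by simp
      fix s n assume "x \<in> E s \<and> length s = n"
      then obtain k where "x \<in> E (s @ [k])" using ext by blast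
      then show "\<exists>t. (x \<in> E t \<and> length t = Suc n) \<and> (\<exists>k. t = s @ [k])"
        using \<open>x \<in> E s \<and> length s = n\<close> by (intro exI[of _ "s @ [k]"]) simp
    qed
    then obtain s where s: "\<And>n. x \<in> E (s n)" "\<And>n. length (s n) = n" "\<And>n. \<exists>k. s (Suc n) = s n @ [k]"
      by blast
    define f where "f n = last (s (Suc n))" for n
    have "s (Suc n) = s n @ [f n]" for n using s(3)[of n] by (auto simp: f_def)
    then have "map f [0..<n] = s n" for n
      using s(2)[of 0] by (induction n) auto
    then have "\<forall>n. x \<in> P (map f [0..<n])" using s(1) inP by simp
    then show False using x(2) by (auto simp: A_def)
  qed
  moreover have "meagre ((\<Union>s. E s - (\<Union>k. E (s @ [k]))) \<union> (\<Union>s. E s - P s))"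
    by (intro meagre_Un meagre_UN m1 m2) auto
  ultimately have "meagre (E [] - A [])" using meagre_subset by blast
  moreover have "meagre (A [] - E [])" by (simp add: E_def meagre_Diff_meagre_hull)
  ultimately have "baire_prop (A [])" using baire_prop_meagre_diff E_bp by blast
  then show ?thesis by (simp add: A_def)
qed

text \<open>Take \<open>P s\<close> to be the closure of the projection of the part of
  \<open>F\<close> over the word \<open>s\<close>. If \<open>x\<close> lies in \<open>P\<close>
  along all of \<open>f\<close>, every basic neighbourhood of \<open>(x, f)\<close> meets
  \<open>F\<close>, and \<open>F\<close> is closed.\<close>

lemma sigma11_Souslin:
  fixes A :: "'a::topological_space set"
  assumes "sigma11 A"
  shows "\<exists>P :: nat list \<Rightarrow> 'a set. (\<forall>s. closed (P s)) \<and> A = {x. \<exists>f. \<forall>n. x \<in> P (map f [0..<n])}"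
proof -
  obtain F :: "('a \<times> (nat \<Rightarrow> nat)) set" where F: "closed F" "A = fst ` F"
    using assms by (auto simp: sigma11_def)
  define P where "P s = closure {x. \<exists>f. (x, f) \<in> F \<and> map f [0..<length s] = s}" for s
  have "(x, f) \<in> F" if "\<forall>n. x \<in> P (map f [0..<n])" for x f
  proof (rule ccontr)
    assume "(x, f) \<notin> F"
    then have "open (- F)" "(x, f) \<in> - F" using F(1) by auto
    then obtain U V where "open U" "open V" "(x, f) \<in> U \<times> V" "U \<times> V \<subseteq> - F"
      by (rule open_prod_elim)
    then have UV: "open U" "open V" "x \<in> U" "f \<in> V" "U \<times> V \<subseteq> - F" by auto
    obtain n where n: "cyl f n \<subseteq> V" using open_contains_cyl UV(2,4) by blast
    have "x \<in> U \<inter> closure {x. \<exists>g. (x, g) \<in> F \<and> map g [0..<n] = map f [0..<n]}"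
      using that[rule_format, of n] UV(3) by (simp add: P_def)
    then have "U \<inter> {x. \<exists>g. (x, g) \<in> F \<and> map g [0..<n] = map f [0..<n]} \<noteq> {}"
      using open_Int_closure_eq_empty[OF UV(1)] by fast
    then obtain y g where "y \<in> U" "(y, g) \<in> F" "map g [0..<n] = map f [0..<n]"
      by auto
    then have "g \<in> V" using n by (auto simp: cyl_def)
    then show False using UV(5) \<open>y \<in> U\<close> \<open>(y, g) \<in> F\<close> by auto
  qed
  moreover have "x \<in> P (map f [0..<n])" if "(x, f) \<in> F" for x f n
  proof -
    have "x \<in> {x. \<exists>g. (x, g) \<in> F \<and> map g [0..<length (map f [0..<n])] = map f [0..<n]}"
      using that by (intro CollectI exI[of _ f]) simp
    then show ?thesis unfolding P_def by (rule subsetD[OF closure_subset])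
  qed
  ultimately have "(\<forall>n. x \<in> P (map f [0..<n])) \<longleftrightarrow> (x, f) \<in> F" for x f
    by blast
  then have "A = {x. \<exists>f. \<forall>n. x \<in> P (map f [0..<n])}"
    by (simp add: F(2) fst_eq_Domain Domain_unfold)
  moreover have "closed (P s)" for s by (simp add: P_def)
  ultimately show ?thesis by blast
qed

text \<open>Inverse images commute with the Souslin operation, so closed sets suffice.\<close>

lemma baire_prop_vimage_sigma11:
  fixes A :: "'a::topological_space set"
  assumes "\<And>C. closed C \<Longrightarrow> baire_prop {x. g x \<in> C}" "sigma11 A"
  shows "baire_prop {x. g x \<in> A}"
proof -
  obtain P :: "nat list \<Rightarrow> 'a set" where P: "\<And>s. closed (P s)" "A = {x. \<exists>f. \<forall>n. x \<in> P (map f [0..<n])}"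
    using sigma11_Souslin[OF assms(2)] by blast
  have "baire_prop {x. \<exists>f. \<forall>n. x \<in> {x. g x \<in> P (map f [0..<n])}}"
    by (rule baire_prop_Souslin) (rule assms(1)[OF P(1)])
  then show ?thesis unfolding P(2) by simp
qed

lemma baire_prop_sigma11: "sigma11 A \<Longrightarrow> baire_prop A"
  by (rule baire_prop_vimage_sigma11[where g = "\<lambda>x. x", simplified])
     (simp_all add: baire_prop_closed)

section \<open>Finite modifications and fusion\<close>

text \<open>Symmetric difference with \<open>F\<close>, on characteristic functions. Finite
  \<open>F\<close> generate \<open>E0\<close>; infinite \<open>F\<close> parametrize the copy of
  Cantor space in \<open>fusion\<close>.\<close>

definition flip :: "nat set \<Rightarrow> (nat \<Rightarrow> bool) \<Rightarrow> nat \<Rightarrow> bool" where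
  "flip F x = (\<lambda>i. x i \<noteq> (i \<in> F))"

lemma flip_flip [simp]: "flip F (flip F x) = x"
  by (auto simp: flip_def)

lemma flip_empty [simp]: "flip {} x = x"
  by (auto simp: flip_def)

lemma flip_in_cyl_iff: "flip F x \<in> cyl a p \<longleftrightarrow> x \<in> cyl (flip F a) p"
  by (auto simp: flip_def cyl_def)

lemma flip_vimage_Cyl: "V \<in> Cyl \<Longrightarrow> flip F -` V \<in> Cyl"
proof -
  assume "V \<in> Cyl"
  then obtain a p where "V = cyl a p" by (auto simp: Cyl_def)
  then have "flip F -` V = cyl (flip F a) p" by (auto simp: flip_in_cyl_iff)
  then show ?thesis by simp
qed

lemma continuous_on_flip: "continuous_on UNIV (flip F)"
proof (rule continuous_on_coordinatewise_then_product)
  fix i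
  have "continuous_on UNIV (\<lambda>b. b \<noteq> (i \<in> F))" by simp
  then have "continuous_on UNIV ((\<lambda>b. b \<noteq> (i \<in> F)) \<circ> (\<lambda>x::nat \<Rightarrow> bool. x i))"
    by (intro continuous_on_compose continuous_on_product_coordinates)
       (rule continuous_on_subset, auto)
  then show "continuous_on UNIV (\<lambda>x. flip F x i)" by (simp add: flip_def comp_def)
qed

lemma nwd_flip: "nwd K \<Longrightarrow> nwd (flip F -` K)"
  unfolding nwd_def
proof
  fix V assume K: "\<forall>V\<in>Cyl. \<exists>W\<in>Cyl. W \<subseteq> V \<and> W \<inter> K = {}" and "V \<in> Cyl"
  then obtain W where W: "W \<in> Cyl" "W \<subseteq> flip F -` V" "W \<inter> K = {}"
    using flip_vimage_Cyl[of V F] by metis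
  have "flip F -` W \<subseteq> V" using W(2) by force
  moreover have "flip F -` W \<inter> flip F -` K = {}" using W(3) by auto
  ultimately show "\<exists>W\<in>Cyl. W \<subseteq> V \<and> W \<inter> flip F -` K = {}"
    using flip_vimage_Cyl[OF W(1), of F] by metis
qed

lemma meagre_flip: "meagre S \<Longrightarrow> meagre (flip F -` S)"
proof -
  assume "meagre S"
  then obtain K where K: "\<And>n::nat. nwd (K n)" "S \<subseteq> (\<Union>n. K n)"
    using meagre_nwd_sequence by blast
  have "meagre (\<Union>n. flip F -` K n)"
    by (intro meagre_UN nwd_imp_meagre nwd_flip K(1)) simp
  then show ?thesis by (rule meagre_subset) (use K(2) in blast)
qed

lemma baire_prop_flip:
  assumes "baire_prop S"
  shows "baire_prop (flip F -` S)"
  unfolding baire_prop_def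
proof
  fix V assume V: "V \<in> Cyl"
  obtain W where W: "W \<in> Cyl" "W \<subseteq> flip F -` V" "meagre (S \<inter> W) \<or> meagre (W - S)"
    using assms flip_vimage_Cyl[OF V, of F] unfolding baire_prop_def by metis
  have "flip F -` W \<subseteq> V" using W(2) by force
  moreover have "meagre (flip F -` S \<inter> flip F -` W) \<or> meagre (flip F -` W - flip F -` S)"
    using W(3) meagre_flip[of "S \<inter> W" F] meagre_flip[of "W - S" F]
    unfolding vimage_Int vimage_Diff by blast
  ultimately show "\<exists>W\<in>Cyl. W \<subseteq> V \<and> (meagre (flip F -` S \<inter> W) \<or> meagre (W - flip F -` S))"
    using flip_vimage_Cyl[OF W(1), of F] by metis
qed

section \<open>Eventual equality as a finite flip\<close>

lemma E0_iff_finite: "(x, y) \<in> E0 \<longleftrightarrow> finite {i. x i \<noteq> y i}"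
proof -
  have "finite {i. x i \<noteq> y i} \<longleftrightarrow> (\<exists>n. {i. x i \<noteq> y i} \<subseteq> {..n})"
    using finite_nat_iff_bounded_le by blast
  also have "\<dots> \<longleftrightarrow> (x, y) \<in> E0"
    unfolding E0_def by (auto simp: subset_iff not_le[symmetric])
  finally show ?thesis by simp
qed

lemma E0_flip: "finite F \<Longrightarrow> (x, flip F x) \<in> E0"
proof -
  have "{i. x i \<noteq> flip F x i} = F" by (auto simp: flip_def)
  then show "finite F \<Longrightarrow> (x, flip F x) \<in> E0" by (simp add: E0_iff_finite)
qed

lemma E0_iff_flip: "(x, y) \<in> E0 \<longleftrightarrow> (\<exists>F. finite F \<and> y = flip F x)"
proof
  assume "(x, y) \<in> E0"
  moreover have "y = flip {i. x i \<noteq> y i} x" by (auto simp: flip_def)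
  ultimately show "\<exists>F. finite F \<and> y = flip F x" unfolding E0_iff_finite by blast
qed (auto intro: E0_flip)

lemma E0_sym: "(x, y) \<in> E0 \<Longrightarrow> (y, x) \<in> E0"
  by (simp add: E0_iff_finite eq_commute)

lemma E0_trans: "(x, y) \<in> E0 \<Longrightarrow> (y, z) \<in> E0 \<Longrightarrow> (x, z) \<in> E0"
  unfolding E0_iff_finite
  by (rule finite_subset[of _ "{i. x i \<noteq> y i} \<union> {i. y i \<noteq> z i}"]) auto

lemma E0_flip_iff:
  assumes "finite F" "finite G"
  shows "(flip F x, flip G y) \<in> E0 \<longleftrightarrow> (x, y) \<in> E0"
  using E0_flip[OF assms(1)] E0_flip[OF assms(2)] E0_sym E0_trans by metis

lemma countable_finite_sets: "countable {F :: nat set. finite F}"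
  by (rule countable_Collect_finite)

section \<open>Fusion along a homomorphism of \<open>E0\<close>\<close>

text \<open>Only countably many pairs of a set in \<open>\<Q>\<close> and a cylinder exist, so one
  meagre set absorbs all errors: almost everywhere on \<open>W\<close> becomes everywhere on
  \<open>W\<close> outside \<open>M\<close>.\<close>

lemma meagre_exception_set:
  assumes "countable \<Q>"
  obtains M where "meagre M"
    "\<And>Q W. Q \<in> \<Q> \<Longrightarrow> W \<in> Cyl \<Longrightarrow> meagre (W - Q) \<Longrightarrow> W - Q \<subseteq> M"
proof -
  define I where "I = {(Q, W) \<in> \<Q> \<times> Cyl. meagre (W - Q)}"
  define M where "M = (\<Union>(Q, W)\<in>I. W - Q)"
  have "countable I"
    by (rule countable_subset[of _ "\<Q> \<times> Cyl"])
       (use assms countable_Cyl in \<open>auto simp: I_def\<close>)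
  then have "meagre M"
    unfolding M_def by (rule meagre_UN) (auto simp: I_def)
  moreover have "W - Q \<subseteq> M" if "Q \<in> \<Q>" "W \<in> Cyl" "meagre (W - Q)" for Q W
    using that by (force simp: M_def I_def)
  ultimately show thesis by (intro that[of M])
qed

text \<open>As \<open>R i\<close> passes to smaller cylinders, the requirements can be met one after
  another.\<close>

lemma finite_refinement:
  assumes "finite I" "V \<in> Cyl"
    and "\<And>i V. i \<in> I \<Longrightarrow> V \<in> Cyl \<Longrightarrow> \<exists>W\<in>Cyl. W \<subseteq> V \<and> R i W"
    and "\<And>i V W. R i V \<Longrightarrow> W \<subseteq> V \<Longrightarrow> R i W"
  shows "\<exists>W\<in>Cyl. W \<subseteq> V \<and> (\<forall>i\<in>I. R i W)"
  using assms(1,3)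
proof (induction I rule: finite_induct)
  case empty
  then show ?case using assms(2) by (intro bexI[of _ V]) auto
next
  case (insert i I)
  have "\<exists>W\<in>Cyl. W \<subseteq> V \<and> (\<forall>i\<in>I. R i W)"
    by (rule insert.IH) (rule insert.prems, simp_all)
  then obtain W where W: "W \<in> Cyl" "W \<subseteq> V" "\<forall>i\<in>I. R i W" by auto
  obtain U where U: "U \<in> Cyl" "U \<subseteq> W" "R i U"
    using insert.prems[of i W] W(1) by auto
  have "\<forall>j\<in>insert i I. R j U" using U W(3) assms(4) by auto
  then show ?case using U W(2) by (intro bexI[of _ U]) auto
qed

text \<open>Stage \<open>n\<close> finds a cylinder where, outside a meagre set, flips up to
  position \<open>p n\<close> leave \<open>\<Phi>\<close> unchanged from \<open>L (Suc n)\<close>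
  on, and where the values below \<open>L (Suc n)\<close> depend only on such a flip. On the
  \<open>n\<close>-th block, bits before \<open>n\<close> thus have no effect by the previous stage,
  and bits after \<open>n\<close> have none by stage \<open>n\<close>.\<close>

lemma fusion:
  fixes \<Phi> :: "(nat \<Rightarrow> bool) \<Rightarrow> nat \<Rightarrow> bool"
  assumes hom: "\<And>x y. (x, y) \<in> E0 \<Longrightarrow> (\<Phi> x, \<Phi> y) \<in> E0"
    and bp: "\<And>k. baire_prop {x. \<Phi> x k}"
    and M: "meagre M" and V: "V \<in> Cyl"
  obtains a p L where "strict_mono (p :: nat \<Rightarrow> nat)" "strict_mono (L :: nat \<Rightarrow> nat)"
    "\<And>B. flip (p ` B) a \<in> V" "\<And>B. flip (p ` B) a \<notin> M"
    "\<And>n B C k. (n \<in> B \<longleftrightarrow> n \<in> C) \<Longrightarrow> L n \<le> k \<Longrightarrow> k < L (Suc n) \<Longrightarrow>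
       \<Phi> (flip (p ` B) a) k = \<Phi> (flip (p ` C) a) k"
proof -
  define S where "S F k = {x. \<Phi> (flip F x) k}" for F k
  define Q where "Q F L = {x. \<forall>k\<ge>L. \<Phi> x k = \<Phi> (flip F x) k}" for F and L :: nat
  have S_bp: "baire_prop (S F k)" for F k
    using baire_prop_flip[OF bp[of k], of F] by (simp add: S_def vimage_def)
  have Q_bp: "baire_prop (Q F L)" for F L
  proof -
    have "Q F L = (\<Inter>k\<in>{L..}. (S {} k \<inter> S F k) \<union> (- S {} k \<inter> - S F k))"
      by (auto simp: Q_def S_def)
    then show ?thesis
      by (simp only:) (intro baire_prop_INT baire_prop_Un baire_prop_Int baire_prop_Compl S_bp, simp)
  qed
  \<comment> \<open>All sets whose almost-containment of cylinders will be used; they are countably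
    many, so a single \<open>N\<close> takes care of the exceptions.\<close>
  define \<Q> where "\<Q> = (\<Union>F\<in>{F. finite F}. \<Union>k. {S F k, - S F k, Q F k})"
  have "countable \<Q>"
    unfolding \<Q>_def by (intro countable_UN countable_finite_sets) auto
  then obtain N where N: "meagre N"
      "\<And>Q W. Q \<in> \<Q> \<Longrightarrow> W \<in> Cyl \<Longrightarrow> meagre (W - Q) \<Longrightarrow> W - Q \<subseteq> N"
    by (rule meagre_exception_set) blast
  \<comment> \<open>Covering \<open>M\<close> and \<open>N\<close> together lets the fusion avoid
    both.\<close>
  obtain K where K: "\<And>n::nat. nwd (K n)" "M \<union> N \<subseteq> (\<Union>n. K n)"
    using meagre_nwd_sequence[OF meagre_Un[OF M N(1)]] by metis
  have Q_dense: "\<exists>W\<in>Cyl. W \<subseteq> U \<and> (\<exists>L. W - N \<subseteq> Q F L)" if F: "finite F" and U: "U \<in> Cyl" for F U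
  proof -
    have "x \<in> (\<Union>L. Q F L)" for x
    proof -
      have "(\<Phi> x, \<Phi> (flip F x)) \<in> E0" by (intro hom E0_flip F)
      then obtain n where "\<forall>k>n. \<Phi> x k = \<Phi> (flip F x) k" by (auto simp: E0_def)
      then have "x \<in> Q F (Suc n)" by (auto simp: Q_def)
      then show ?thesis by blast
    qed
    \<comment> \<open>Each point has its own bound \<open>L\<close>; category makes it uniform on a
      subcylinder.\<close>
    then have "U \<subseteq> (\<Union>L\<in>UNIV. Q F L)" by blast
    from baire_prop_cover[OF U _ Q_bp this]
    obtain L W where W: "W \<in> Cyl" "W \<subseteq> U" "meagre (W - Q F L)" by auto
    have "Q F L \<in> \<Q>" using F by (auto simp: \<Q>_def)
    then have "W - Q F L \<subseteq> N" using N(2) W(1,3) by blast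
    then have "W - N \<subseteq> Q F L" by blast
    then show ?thesis using W(1,2) by blast
  qed
  have S_dense: "\<exists>W\<in>Cyl. W \<subseteq> U \<and> (W - N \<subseteq> S F k \<or> W - N \<subseteq> - S F k)"
    if F: "finite F" and U: "U \<in> Cyl" for F U k
  proof -
    obtain W where W: "W \<in> Cyl" "W \<subseteq> U" "meagre (S F k \<inter> W) \<or> meagre (W - S F k)"
      using S_bp[of F k] U unfolding baire_prop_def by meson
    have "S F k \<in> \<Q>" "- S F k \<in> \<Q>" using F by (auto simp: \<Q>_def)
    moreover have "S F k \<inter> W = W - (- S F k)" by auto
    ultimately have "W - (- S F k) \<subseteq> N \<or> W - S F k \<subseteq> N"
      using N(2) W(1,3) by metis
    then have "W - N \<subseteq> S F k \<or> W - N \<subseteq> - S F k" by blast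
    then show ?thesis using W(1,2) by blast
  qed
  \<comment> \<open>A state is a cylinder \<open>cyl a p\<close> with a block boundary
    \<open>L\<close>. The sets \<open>F\<close> may contain \<open>p\<close> itself, the position of
    the next free bit.\<close>
  define step where "step n s t \<longleftrightarrow> (case s of (a, p, L) \<Rightarrow> case t of (a', p', L') \<Rightarrow>
      a' \<in> cyl a p \<and> p < p' \<and> L < L' \<and>
      (\<forall>F\<in>Pow {..p}. cyl a' p' \<inter> flip F -` K n = {}) \<and>
      (\<forall>F\<in>Pow {..p}. cyl a' p' - N \<subseteq> Q F L') \<and>
      (\<forall>F\<in>Pow {..p}. \<forall>k<L'. cyl a' p' - N \<subseteq> S F k \<or> cyl a' p' - N \<subseteq> - S F k))"
    for n and s t :: "(nat \<Rightarrow> bool) \<times> nat \<times> nat"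
  have step_ex: "\<exists>t. step n s t" for n s
  proof -
    obtain a p L where s: "s = (a, p, L)" by (cases s)
    have fin: "finite F" if "F \<in> Pow {..p}" for F
      using that finite_subset by blast
    have "\<exists>W\<in>Cyl. W \<subseteq> cyl a p \<and> (\<forall>F\<in>Pow {..p}. W \<inter> flip F -` K n = {})"
    proof (rule finite_refinement[where R = "\<lambda>F W. W \<inter> flip F -` K n = {}"])
      show "\<exists>W\<in>Cyl. W \<subseteq> V \<and> W \<inter> flip F -` K n = {}" if "V \<in> Cyl" for F V
        using nwd_flip[OF K(1)[of n], of F] that unfolding nwd_def by meson
    qed auto
    then obtain W1 where W1: "W1 \<in> Cyl" "W1 \<subseteq> cyl a p"
      "\<forall>F\<in>Pow {..p}. W1 \<inter> flip F -` K n = {}" by meson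
    have "\<exists>W\<in>Cyl. W \<subseteq> W1 \<and> (\<forall>F\<in>Pow {..p}. \<exists>L. W - N \<subseteq> Q F L)"
      by (rule finite_refinement[where R = "\<lambda>F W. \<exists>L. W - N \<subseteq> Q F L", OF _ W1(1) Q_dense[OF fin]])
         (simp_all, meson Diff_mono order_refl order_trans)
    then obtain W2 where W2: "W2 \<in> Cyl" "W2 \<subseteq> W1" "\<forall>F\<in>Pow {..p}. \<exists>L. W2 - N \<subseteq> Q F L"
      by meson
    then obtain l where l: "\<And>F. F \<in> Pow {..p} \<Longrightarrow> W2 - N \<subseteq> Q F (l F)" by metis
    \<comment> \<open>The sum bounds all \<open>l F\<close> at once; \<open>Suc\<close> keeps the
      boundaries strictly increasing.\<close>
    define L' where "L' = Suc (L + sum l (Pow {..p}))"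
    have Q2: "W2 - N \<subseteq> Q F L'" if "F \<in> Pow {..p}" for F
    proof -
      have "l F \<le> sum l (Pow {..p})" using that by (intro member_le_sum) auto
      then have "Q F (l F) \<subseteq> Q F L'" by (auto simp: Q_def L'_def)
      then show ?thesis using l[OF that] by blast
    qed
    have "\<exists>W\<in>Cyl. W \<subseteq> W2 \<and> (\<forall>(F, k)\<in>Pow {..p} \<times> {..<L'}. W - N \<subseteq> S F k \<or> W - N \<subseteq> - S F k)"
      unfolding case_prod_beta
    proof (rule finite_refinement[where
          R = "\<lambda>i W. W - N \<subseteq> S (fst i) (snd i) \<or> W - N \<subseteq> - S (fst i) (snd i)", OF _ W2(1)])
      show "\<exists>W\<in>Cyl. W \<subseteq> V \<and> (W - N \<subseteq> S (fst i) (snd i) \<or> W - N \<subseteq> - S (fst i) (snd i))"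
        if "i \<in> Pow {..p} \<times> {..<L'}" "V \<in> Cyl" for i V
        using that by (intro S_dense fin) auto
    qed auto
    then obtain W3 where W3: "W3 \<in> Cyl" "W3 \<subseteq> W2"
      "\<forall>(F, k)\<in>Pow {..p} \<times> {..<L'}. W3 - N \<subseteq> S F k \<or> W3 - N \<subseteq> - S F k" by meson
    obtain b q where bq: "W3 = cyl b q" using W3(1) by (auto simp: Cyl_def)
    define p' where "p' = max q (Suc p)"
    have sub: "cyl b p' \<subseteq> W3" unfolding bq p'_def by (intro cyl_antimono) simp
    have "step n s (b, p', L')"
      unfolding step_def s prod.case
    proof (intro conjI ballI allI impI)
      show "b \<in> cyl a p" using W1(2) W2(2) W3(2) bq cyl_self[of b q] by blast
      show "p < p'" "L < L'" by (auto simp: p'_def L'_def)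
      fix F assume F: "F \<in> Pow {..p}"
      show "cyl b p' \<inter> flip F -` K n = {}"
        using sub W2(2) W3(2) bspec[OF W1(3) F] by blast
      show "cyl b p' - N \<subseteq> Q F L'" using sub W3(2) Q2[OF F] by blast
      fix k assume "k < L'"
      then have "W3 - N \<subseteq> S F k \<or> W3 - N \<subseteq> - S F k" using W3(3) F by auto
      then show "cyl b p' - N \<subseteq> S F k \<or> cyl b p' - N \<subseteq> - S F k" using sub by blast
    qed
    then show ?thesis by blast
  qed
  obtain a0 p0 where V_eq: "V = cyl a0 p0" using V by (auto simp: Cyl_def)
  have "\<exists>f. \<forall>n. (n = 0 \<longrightarrow> f n = (a0, p0, 0)) \<and> step n (f n) (f (Suc n))"
    by (rule dependent_nat_choice) (use step_ex in auto)
  then obtain f where f: "f 0 = (a0, p0, 0)" "\<And>n. step n (f n) (f (Suc n))" by blast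
  define a where "a n = fst (f n)" for n
  define p where "p n = fst (snd (f n))" for n
  define L where "L n = snd (snd (f n))" for n
  have "step n (a n, p n, L n) (a (Suc n), p (Suc n), L (Suc n))" for n
    using f(2)[of n] by (simp add: a_def p_def L_def)
  then have
    a_step: "a (Suc n) \<in> cyl (a n) (p n)" and
    "p n < p (Suc n)" "L n < L (Suc n)" and
    avoid: "F \<subseteq> {..p n} \<Longrightarrow> y \<in> cyl (a (Suc n)) (p (Suc n)) \<Longrightarrow> flip F y \<notin> K n" and
    tail: "F \<subseteq> {..p n} \<Longrightarrow> y \<in> cyl (a (Suc n)) (p (Suc n)) \<Longrightarrow> y \<notin> N \<Longrightarrow> L (Suc n) \<le> k \<Longrightarrow>
      \<Phi> y k = \<Phi> (flip F y) k" and
    block: "F \<subseteq> {..p n} \<Longrightarrow> y \<in> cyl (a (Suc n)) (p (Suc n)) \<Longrightarrow> y \<notin> N \<Longrightarrow>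
      z \<in> cyl (a (Suc n)) (p (Suc n)) \<Longrightarrow> z \<notin> N \<Longrightarrow> k < L (Suc n) \<Longrightarrow>
      \<Phi> (flip F y) k = \<Phi> (flip F z) k" for n F y z k
    unfolding step_def prod.case Q_def S_def by blast+
  then have mono: "strict_mono p" "strict_mono L" by (auto simp: strict_mono_Suc_iff)
  obtain c where c: "\<And>n. c \<in> cyl (a n) (p n)"
    using cyl_limit[OF a_step mono(1)] by metis
  \<comment> \<open>The \<open>n\<close>-th free bit sits at position \<open>p n\<close>, so
    \<open>X\<close> is a copy of Cantor space indexed by sets of naturals.\<close>
  define X where "X B = flip (p ` B) c" for B
  have X_cyl: "X B \<in> cyl (a n) (p n)" if "B \<inter> {..<n} = {}" for B n
  proof -
    have "i \<notin> p ` B" if "i < p n" for i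
      using that \<open>B \<inter> {..<n} = {}\<close> mono(1) by (auto simp: strict_mono_less)
    then show ?thesis using c[of n] by (simp add: X_def flip_def cyl_def)
  qed
  have X_split: "X B = flip (p ` (B \<inter> C)) (X (B - C))" for B C
  proof -
    have "inj p" using mono(1) by (rule strict_mono_imp_inj_on)
    then show ?thesis by (auto simp: X_def flip_def fun_eq_iff inj_image_mem_iff dest: injD)
  qed
  have image_le: "p ` (B \<inter> {..n}) \<subseteq> {..p n}" for B n
    using mono(1) by (auto simp: strict_mono_less_eq)
  have X_avoid: "X B \<notin> K n" for B n
  proof -
    \<comment> \<open>Without the flips at bits up to \<open>n\<close>, the point lies in the
      cylinder of index \<open>Suc n\<close>, which stays off \<open>K n\<close> under all these
      flips.\<close>
    have "X (B - {..n}) \<in> cyl (a (Suc n)) (p (Suc n))" by (rule X_cyl) auto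
    then show ?thesis using avoid[OF image_le] X_split[of B "{..n}"] by metis
  qed
  then have X_notin: "X B \<notin> M" "X B \<notin> N" for B
    using K(2) by blast+
  \<comment> \<open>The stage preceding \<open>n\<close> discards the bits before \<open>n\<close>;
    for \<open>n = 0\<close> there are none.\<close>
  have tail': "\<Phi> (X B) k = \<Phi> (X (B - {..<n})) k" if "L n \<le> k" for B n k
  proof (cases n)
    case (Suc m)
    have "X (B - {..m}) \<in> cyl (a (Suc m)) (p (Suc m))" by (rule X_cyl) auto
    then have "\<Phi> (X (B - {..m})) k = \<Phi> (flip (p ` (B \<inter> {..m})) (X (B - {..m}))) k"
      by (rule tail[OF image_le]) (use X_notin(2) that Suc in auto)
    then show ?thesis unfolding Suc lessThan_Suc_atMost X_split[of B "{..m}", symmetric] ..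
  qed simp
  have "\<Phi> (X B) k = \<Phi> (X C) k" if n: "n \<in> B \<longleftrightarrow> n \<in> C" "L n \<le> k" "k < L (Suc n)" for n B C k
  proof -
    \<comment> \<open>By \<open>tail'\<close> only bits from \<open>n\<close> on matter. The common
      bit \<open>n\<close> amounts to one flip \<open>F\<close>, after which stage \<open>n\<close>
      fixes the value whatever the later bits are.\<close>
    define F where "F = p ` (B \<inter> {n})"
    have F: "F \<subseteq> {..p n}" by (auto simp: F_def)
    have C: "C \<inter> {n} = B \<inter> {n}" using n(1) by auto
    have B': "X (B - {..<n}) = flip F (X (B - {..n}))"
      and C': "X (C - {..<n}) = flip F (X (C - {..n}))"
    proof -
      have "(D - {..<n}) \<inter> {n} = D \<inter> {n}" "D - {..<n} - {n} = D - {..n}" for D :: "nat set"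
        by auto
      then show "X (B - {..<n}) = flip F (X (B - {..n}))" "X (C - {..<n}) = flip F (X (C - {..n}))"
        using X_split[of "B - {..<n}" "{n}"] X_split[of "C - {..<n}" "{n}"] C by (simp_all add: F_def)
    qed
    have "\<Phi> (X (B - {..<n})) k = \<Phi> (X (C - {..<n})) k"
      unfolding B' C' by (rule block[OF F X_cyl X_notin(2) X_cyl X_notin(2) n(3)]) auto
    then show ?thesis using tail'[OF n(2)] by metis
  qed
  moreover have "X B \<in> V" for B
    using X_cyl[of B 0] V_eq f(1) by (simp add: a_def p_def)
  ultimately show thesis
    using that[of p L c] mono X_notin(1) unfolding X_def by blast
qed

section \<open>The sets \<open>D k\<close>\<close>

lemma topspace_power [simp]:
  "topspace (power_topology n :: (nat \<Rightarrow> 'a::topological_space) topology) = (\<Pi>\<^sub>E i\<in>{..<n}. UNIV)"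
  by (simp add: power_topology_def)

lemma openin_D: "openin (power_topology 3) (D k)"
proof -
  have coord: "openin (power_topology 3) {p \<in> topspace (power_topology 3). p i n = b}"
    if "i < 3" for i n :: nat and b :: bool
  proof -
    have "open ((\<lambda>x::nat \<Rightarrow> bool. x n) -` {b})"
      by (intro open_vimage continuous_on_product_coordinates open_discrete)
    moreover have "continuous_map (power_topology 3) (euclidean :: (nat \<Rightarrow> bool) topology) (\<lambda>p. p i)"
      unfolding power_topology_def using that by (intro continuous_map_product_projection) simp
    ultimately show ?thesis
      using openin_continuous_map_preimage[of "power_topology 3" euclidean "\<lambda>p. p i"
          "(\<lambda>x::nat \<Rightarrow> bool. x n) -` {b}"]
      by simp
  qed
  \<comment> \<open>Prescribing the bits involved turns the inequalities into intersections of open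
    coordinate conditions.\<close>
  have eq: "D k = (\<Union>n\<in>{k..}. \<Union>b. \<Union>c.
      {p \<in> topspace (power_topology 3). p 0 n = b} \<inter> {p \<in> topspace (power_topology 3). p 1 n = (\<not> b)} \<inter>
      {p \<in> topspace (power_topology 3). p 2 n = (\<not> b)} \<inter>
      {p \<in> topspace (power_topology 3). p 1 (n + 1) = c} \<inter>
      {p \<in> topspace (power_topology 3). p 2 (n + 1) = (\<not> c)})"
    unfolding D_def by auto
  show ?thesis
    unfolding eq
    by (rule openin_Union, elim imageE, simp only:)+ (intro openin_Int coord, simp_all)
qed

lemma D_dense:
  "power_topology 3 closure_of D k = topspace (power_topology 3)"
proof (rule antisym)
  show "topspace (power_topology 3) \<subseteq> power_topology 3 closure_of D k"
  proof
    fix p :: "nat \<Rightarrow> nat \<Rightarrow> bool"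
    assume p: "p \<in> topspace (power_topology 3)"
    have "\<exists>q\<in>D k. q \<in> T" if T: "p \<in> T" "openin (power_topology 3) T" for T
    proof -
      obtain U where U: "p \<in> (\<Pi>\<^sub>E i\<in>{..<3}. U i)" "\<And>i. open (U i)" "(\<Pi>\<^sub>E i\<in>{..<3}. U i) \<subseteq> T"
        using product_topology_open_contains_basis[OF T(2)[unfolded power_topology_def] T(1)]
        by auto
      have "\<forall>i\<in>{..<3}. \<exists>n. cyl (p i) n \<subseteq> U i"
        using U(1,2) by (intro ballI open_contains_cyl) auto
      then obtain l where l: "\<And>i. i < 3 \<Longrightarrow> cyl (p i) (l i) \<subseteq> U i"
        by (metis lessThan_iff)
      define n where "n = k + l 0 + l 1 + l 2"
      \<comment> \<open>From \<open>n\<close> on, the three sequences are constantly true, true only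
        at \<open>n + 1\<close>, and constantly false.\<close>
      define q where "q = (\<lambda>i\<in>{..<3}. \<lambda>m. if m < n then p i m else i = 0 \<or> i = 1 \<and> m = n + 1)"
      have l_le: "l i \<le> n" if "i < 3" for i
      proof -
        have "i = 0 \<or> i = 1 \<or> i = 2" using that by auto
        then show ?thesis by (auto simp: n_def)
      qed
      have "q i \<in> U i" if "i < 3" for i
      proof -
        have "q i \<in> cyl (p i) (l i)"
          using that l_le[OF that] by (auto simp: q_def cyl_def)
        then show ?thesis using l[OF that] by blast
      qed
      then have "q \<in> (\<Pi>\<^sub>E i\<in>{..<3}. U i)" by (auto simp: q_def)
      moreover have "q \<in> D k"
        unfolding D_def by (auto simp: q_def n_def intro!: exI[of _ n])
      ultimately show ?thesis using U(3) by blast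
    qed
    then show "p \<in> power_topology 3 closure_of D k"
      using p by (auto simp: in_closure_of)
  qed
qed (rule closure_of_subset_topspace)

lemma comeager_INT_dense_open:
  fixes U :: "nat \<Rightarrow> 'a set"
  assumes "\<And>k. openin T (U k)" "\<And>k. T closure_of U k = topspace T"
  shows "comeager_in T (\<Inter>k. U k)"
proof -
  have "nowhere_dense_in T (topspace T - U k)" for k
  proof -
    have "closedin T (topspace T - U k)" using assms(1) by blast
    then show ?thesis
      using assms(2) by (simp add: nowhere_dense_in_def closure_of_closedin interior_of_complement)
  qed
  moreover have "topspace T - (\<Inter>k. U k) = (\<Union>k. topspace T - U k)" by auto
  ultimately have "meager_in T (topspace T - (\<Inter>k. U k))"
    unfolding meager_in_def by (intro exI[of _ "\<lambda>k. topspace T - U k"]) simp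
  moreover have "(\<Inter>k. U k) \<subseteq> topspace T"
    using assms(1) openin_subset by blast
  ultimately show ?thesis by (simp add: comeager_in_def)
qed

section \<open>Reductions\<close>

lemma baire_prop_vimage_open:
  assumes "delta11_fun_on UNIV \<Phi>" "open U"
  shows "baire_prop (\<Phi> -` U)"
proof -
  have "sigma11 {x \<in> UNIV. \<Phi> x \<in> U}"
    using assms unfolding delta11_fun_on_def delta11_def by blast
  then show ?thesis using baire_prop_sigma11 by (simp add: vimage_def)
qed

text \<open>Continuity of the flip handles closed sets; the Souslin operation then handles the
  analytic set \<open>A\<close>.\<close>

lemma baire_prop_flip_reduction:
  assumes \<Phi>: "delta11_fun_on UNIV \<Phi>" and "delta11 A"
  shows "baire_prop {x. flip F (\<Phi> x) \<in> A}"
proof (rule baire_prop_vimage_sigma11)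
  fix C :: "(nat \<Rightarrow> bool) set" assume "closed C"
  then have "open (flip F -` (- C))"
    by (intro open_vimage continuous_on_flip) auto
  then have "baire_prop (- (\<Phi> -` flip F -` (- C)))"
    by (intro baire_prop_Compl baire_prop_vimage_open \<Phi>)
  moreover have "- (\<Phi> -` flip F -` (- C)) = {x. flip F (\<Phi> x) \<in> C}" by auto
  ultimately show "baire_prop {x. flip F (\<Phi> x) \<in> C}" by simp
qed (use assms(2) in \<open>simp add: delta11_def\<close>)

text \<open>Each value is a finite flip away from \<open>A\<close>, and there are countably many
  finite sets, so one of them works on almost all of a subcylinder.\<close>

lemma flip_into_saturation:
  assumes "delta11_fun_on UNIV \<Phi>" "delta11 A" "\<And>x. \<Phi> x \<in> E0 `` A" "V \<in> Cyl"
  shows "\<exists>F. finite F \<and> (\<exists>W\<in>Cyl. W \<subseteq> V \<and> meagre (W - {x. flip F (\<Phi> x) \<in> A}))"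
proof -
  have "x \<in> (\<Union>F\<in>{F. finite F}. {x. flip F (\<Phi> x) \<in> A})" for x
  proof -
    obtain y where "y \<in> A" "(\<Phi> x, y) \<in> E0"
      using assms(3)[of x] E0_sym by blast
    then show ?thesis unfolding E0_iff_flip by blast
  qed
  then have "V \<subseteq> (\<Union>F\<in>{F. finite F}. {x. flip F (\<Phi> x) \<in> A})" by blast
  from baire_prop_cover[OF assms(4) countable_finite_sets
      baire_prop_flip_reduction[OF assms(1,2)] this]
  show ?thesis by auto
qed

lemma prod_mod_not_subset_D:
  fixes A :: "nat \<Rightarrow> (nat \<Rightarrow> bool) set"
  assumes A: "\<forall>i<3. delta11 (A i)"
    and red: "delta11_reducible UNIV E0 (A 0) (Restr E0 (A 0))"
    and sat: "E0 `` A 0 = E0 `` A 1" "E0 `` A 1 = E0 `` A 2"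
  shows "\<not> prod_mod 3 E0 A \<subseteq> (\<Inter>k. D k)"
proof -
  obtain \<Phi> where \<Phi>: "range \<Phi> \<subseteq> A 0" "delta11_fun_on UNIV \<Phi>"
    "\<And>x y. (x, y) \<in> E0 \<longleftrightarrow> (\<Phi> x, \<Phi> y) \<in> Restr E0 (A 0)"
    using red by (auto simp: delta11_reducible_def)
  have hom: "(x, y) \<in> E0 \<longleftrightarrow> (\<Phi> x, \<Phi> y) \<in> E0" for x y
    using \<Phi>(1,3) by blast
  then have hom': "(\<Phi> x, \<Phi> y) \<in> E0" if "(x, y) \<in> E0" for x y
    using that by blast
  have in0: "\<Phi> x \<in> E0 `` A 0" for x
  proof -
    have "(\<Phi> x, \<Phi> x) \<in> E0" by (simp add: E0_def)
    then show ?thesis using \<Phi>(1) by blast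
  qed
  have delta: "delta11 (A 1)" "delta11 (A 2)" using A by simp_all
  obtain F1 V1 where 1: "finite F1" "V1 \<in> Cyl" "meagre (V1 - {x. flip F1 (\<Phi> x) \<in> A 1})"
    using flip_into_saturation[OF \<Phi>(2) delta(1) _ UNIV_in_Cyl] in0 sat by metis
  \<comment> \<open>Starting from \<open>V1\<close> makes both modifications available on
    \<open>V2\<close>.\<close>
  obtain F2 V2 where 2: "finite F2" "V2 \<in> Cyl" "V2 \<subseteq> V1"
      "meagre (V2 - {x. flip F2 (\<Phi> x) \<in> A 2})"
    using flip_into_saturation[OF \<Phi>(2) delta(2) _ 1(2)] in0 sat by metis
  have bp: "baire_prop {x. \<Phi> x k}" for k
  proof -
    have "open ((\<lambda>x::nat \<Rightarrow> bool. x k) -` {True})"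
      by (intro open_vimage continuous_on_product_coordinates open_discrete)
    from baire_prop_vimage_open[OF \<Phi>(2) this] show ?thesis by (simp add: vimage_def)
  qed
  \<comment> \<open>Fusion inside \<open>V2\<close> avoids the points where a modification fails, so
    on the whole copy of Cantor space the modified images lie in \<open>A 1\<close> and
    \<open>A 2\<close>.\<close>
  obtain a p L where mono: "strict_mono (p :: nat \<Rightarrow> nat)" "strict_mono (L :: nat \<Rightarrow> nat)"
    and V2: "\<And>B. flip (p ` B) a \<in> V2"
    and avoid: "\<And>B. flip (p ` B) a \<notin>
      (V1 - {x. flip F1 (\<Phi> x) \<in> A 1}) \<union> (V2 - {x. flip F2 (\<Phi> x) \<in> A 2})"
    and block: "\<And>n B C k. (n \<in> B \<longleftrightarrow> n \<in> C) \<Longrightarrow> L n \<le> k \<Longrightarrow> k < L (Suc n) \<Longrightarrow>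
       \<Phi> (flip (p ` B) a) k = \<Phi> (flip (p ` C) a) k"
    by (rule fusion[where \<Phi> = \<Phi>])
       (erule hom', rule bp, rule meagre_Un[OF 1(3) 2(4)], rule 2(2), rule that)
  define Y where "Y B = \<Phi> (flip (p ` B) a)" for B
  \<comment> \<open>Injectivity of \<open>p\<close> matches differences of index sets with
    differences of points, and the reduction transfers \<open>E0\<close> in both directions.\<close>
  have Y_E0: "(Y B, Y C) \<in> E0 \<longleftrightarrow> finite {n. n \<in> B \<longleftrightarrow> n \<notin> C}" for B C
  proof -
    have inj: "inj p" using mono(1) by (rule strict_mono_imp_inj_on)
    have "{i. flip (p ` B) a i \<noteq> flip (p ` C) a i} = p ` {n. n \<in> B \<longleftrightarrow> n \<notin> C}"
      using inj by (auto simp: flip_def dest: injD)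
    then show ?thesis
      unfolding Y_def hom[symmetric] unfolding E0_iff_finite
      using inj by (simp add: finite_image_iff inj_on_def)
  qed
  have infinite_residue: "infinite {n::nat. n mod 4 = r}" if "r < 4" for r
  proof -
    have "range (\<lambda>m. 4 * m + r) \<subseteq> {n. n mod 4 = r}" using that by auto
    moreover have "infinite (range (\<lambda>m. 4 * m + r))"
      by (intro range_inj_infinite injI) simp
    ultimately show ?thesis using finite_subset by blast
  qed
  \<comment> \<open>Residues 0 and 2 are not adjacent: a block of residue 0 and its successor both
    avoid residue 2.\<close>
  define B where "B = (\<lambda>i::nat. if i = 0 then {n::nat. n mod 4 = 0} else if i = 1 then {n. n mod 4 = 2} else {})"
  \<comment> \<open>Values of \<open>\<Phi>\<close> already lie in \<open>A 0\<close>, so coordinate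
    0 is left unmodified.\<close>
  define F where "F = (\<lambda>i::nat. if i = 0 then {} else if i = 1 then F1 else F2)"
  define q where "q = (\<lambda>i\<in>{..<3}. flip (F i) (Y (B i)))"
  have F_fin: "finite (F i)" for i using 1(1) 2(1) by (simp add: F_def)
  have B_diff: "infinite {n. n \<in> B i \<longleftrightarrow> n \<notin> B j}" if "i < 3" "j < 3" "i \<noteq> j" for i j
  proof -
    have "\<exists>r<4. {n. n mod 4 = r} \<subseteq> {n. n \<in> B i \<longleftrightarrow> n \<notin> B j}"
    proof (cases "i = 0 \<or> j = 0")
      case True
      then show ?thesis using that by (intro exI[of _ 0]) (auto simp: B_def)
    next
      case False
      then show ?thesis using that by (intro exI[of _ 2]) (auto simp: B_def)
    qed
    then show ?thesis using infinite_residue finite_subset by blast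
  qed
  have "q \<in> prod_mod 3 E0 A"
  proof -
    have "q i \<in> A i" if "i < 3" for i
    proof -
      have "Y (B 0) \<in> A 0" using \<Phi>(1) by (auto simp: Y_def)
      moreover have "flip F1 (Y (B 1)) \<in> A 1" "flip F2 (Y (B 2)) \<in> A 2"
        using avoid V2 2(3) unfolding Y_def by blast+
      moreover have "i = 0 \<or> i = 1 \<or> i = 2" using that by auto
      ultimately show ?thesis by (auto simp: q_def F_def)
    qed
    moreover have "(q i, q j) \<notin> E0" if "i < 3" "j < 3" "i \<noteq> j" for i j
      using that B_diff[OF that] by (simp add: q_def E0_flip_iff[OF F_fin F_fin] Y_E0)
    ultimately show ?thesis by (auto simp: prod_mod_def q_def)
  qed
  \<comment> \<open>From \<open>k\<close> on the finite modifications are invisible, and every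
    coordinate belongs to a block, as the blocks start at \<open>L 0\<close>.\<close>
  moreover obtain k where k: "L 0 \<le> k" "\<And>i. i \<in> F1 \<union> F2 \<Longrightarrow> i < k"
  proof -
    obtain k where "F1 \<union> F2 \<subseteq> {..<k}"
      using finite_nat_bounded[of "F1 \<union> F2"] 1(1) 2(1) by auto
    then show thesis by (intro that[of "max k (L 0)"]) auto
  qed
  have "q \<notin> D k"
  proof
    assume "q \<in> D k"
    then obtain m where m: "m \<ge> k" "q 0 m \<noteq> q 1 m" "q 0 m \<noteq> q 2 m" "q 1 (m + 1) \<noteq> q 2 (m + 1)"
      by (auto simp: D_def)
    have "q i l = Y (B i) l" if "i < 3" "l \<ge> k" for i l
      using that k(2)[of l] by (auto simp: q_def flip_def F_def)
    then have Y: "Y (B 0) m \<noteq> Y (B 1) m" "Y (B 0) m \<noteq> Y (B 2) m" "Y (B 1) (m + 1) \<noteq> Y (B 2) (m + 1)"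
      using m by auto
    have ge: "n \<le> L n" for n using mono(2) by (rule strict_mono_imp_increasing)
    \<comment> \<open>The index of the block containing \<open>m\<close>; it is at most
      \<open>m\<close> because \<open>n \<le> L n\<close>.\<close>
    define n where "n = (GREATEST n. L n \<le> m)"
    have "L n \<le> m"
      unfolding n_def
      by (rule GreatestI_nat[where P = "\<lambda>n. L n \<le> m" and b = m]) (use k(1) m(1) ge in \<open>auto intro: order_trans\<close>)
    moreover have "\<not> L (Suc n) \<le> m"
    proof
      assume "L (Suc n) \<le> m"
      then have "Suc n \<le> n"
        unfolding n_def
        by (rule Greatest_le_nat[where P = "\<lambda>n. L n \<le> m" and b = m]) (use ge in \<open>auto intro: order_trans\<close>)
      then show False by simp
    qed
    ultimately have n: "L n \<le> m" "m < L (Suc n)" by auto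
    \<comment> \<open>\<open>B 0\<close> and \<open>B 2\<close> differ only at multiples of 4, so
      only such blocks separate their images.\<close>
    have n_mod: "n mod 4 = 0"
    proof (rule ccontr)
      assume "n mod 4 \<noteq> 0"
      then have "n \<in> B 0 \<longleftrightarrow> n \<in> B 2" by (auto simp: B_def)
      then show False using block[OF _ n] Y(2) unfolding Y_def by blast
    qed
    \<comment> \<open>Blocks are nonempty, so \<open>m + 1\<close> lies in the same block as
      \<open>m\<close> or in the next one.\<close>
    obtain n' where n': "n' = n \<or> n' = Suc n" "L n' \<le> m + 1" "m + 1 < L (Suc n')"
    proof (cases "m + 1 < L (Suc n)")
      case True
      then show thesis using n by (intro that[of n]) auto
    next
      case False
      moreover have "L (Suc n) < L (Suc (Suc n))" using mono(2) by (simp add: strict_mono_Suc_iff)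
      ultimately show thesis using n by (intro that[of "Suc n"]) auto
    qed
    \<comment> \<open>The residue is 0 or 1, while \<open>B 1\<close> and \<open>B 2\<close> differ
      only at residue 2.\<close>
    have "n' mod 4 \<noteq> 2"
      using n'(1) n_mod by (auto simp: mod_Suc)
    then have "n' \<in> B 1 \<longleftrightarrow> n' \<in> B 2" by (auto simp: B_def)
    then show False using block[OF _ n'(2,3)] Y(3) unfolding Y_def by blast
  qed
  ultimately show ?thesis by blast
qed

theorem theorem8p2:
  shows "(\<forall>k. openin (power_topology 3) (D k) \<and>
              power_topology 3 closure_of D k = topspace (power_topology 3)) \<and>
         comeager_in (power_topology 3) (\<Inter>k. D k) \<and>
         (\<forall>A :: nat \<Rightarrow> (nat \<Rightarrow> bool) set.
            (\<forall>i<3. delta11 (A i)) \<longrightarrow>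
            (\<forall>i<3. delta11_reducible UNIV E0 (A i) (Restr E0 (A i))) \<longrightarrow>
            E0 `` A 0 = E0 `` A 1 \<longrightarrow> E0 `` A 1 = E0 `` A 2 \<longrightarrow>
            \<not> prod_mod 3 E0 A \<subseteq> (\<Inter>k. D k)) \<and>
         \<not> weak_mycielski 3 E0"
proof -
  have comeager: "comeager_in (power_topology 3) (\<Inter>k. D k)"
    by (rule comeager_INT_dense_open[OF openin_D D_dense])
  moreover have "\<not> weak_mycielski 3 E0"
  proof
    assume "weak_mycielski 3 E0"
    then obtain A where "\<forall>i<3. delta11 (A i) \<and> delta11_bireducible UNIV E0 (A i) (Restr E0 (A i))"
      and sat: "\<forall>i<3. \<forall>j<3. E0 `` A i = E0 `` A j" and sub: "prod_mod 3 E0 A \<subseteq> (\<Inter>k. D k)"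
      using comeager unfolding weak_mycielski_def by meson
    then have "\<forall>i<3. delta11 (A i)" "delta11_reducible UNIV E0 (A 0) (Restr E0 (A 0))"
      by (auto simp: delta11_bireducible_def)
    moreover have "E0 `` A 0 = E0 `` A 1" "E0 `` A 1 = E0 `` A 2"
      using sat by simp_all
    ultimately show False using prod_mod_not_subset_D sub by blast
  qed
  ultimately show ?thesis
    using openin_D D_dense prod_mod_not_subset_D by simp
qed

end
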